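(* Let $\mathcal{A}_m\subset\Omega_{n_m}$ ($m=1,2,\dots$) be a sequence of monotone events with $\inf_m I\!I(\mathcal{A}_m)>0$. Then $\{\mathcal{A}_m\}$ is not asymptotically noise sensitive.
   Context: $\Omega_n=\{0,1\}^n$ carries the uniform probability measure $\mathbf{P}$; an event is a subset $\mathcal{A}\subset\Omega_n$. A function $f:\Omega_n\to\mathbb{R}$ is monotone if $f(x)\le f(y)$ whenever $x_j\le y_j$ for all $j$; an event is monotone if its indicator function $\chi_{\mathcal{A}}$ is monotone. Influences: for $x\in\Omega_n$ and $j\in\{1,\dots,n\}$, $\sigma_jx$ is $x$ with the $j$-th coordinate replaced by $1-x_j$. For $f:\Omega_n\to\mathbb{R}$, $I_k(f)=\mathbf{E}|f(\sigma_kx)-f(x)|$ (with $x$ uniform), and $I\!I(f)=\sum_{k=1}^n I_k(f)^2$. For an event, $I\!I(\mathcal{A})=I\!I(\chi_{\mathcal{A}})$. Noise: for $x\in\Omega_n$ and $\epsilon\in(0,1)$, $N_\epsilon(x)$ is the random element of $\Omega_n$ whose coordinates are, independently, $x_j$ with probability $1-\epsilon$ and $1-x_j$ with probability $\epsilon$. Sensitivity gauge: for an event $\mathcal{A}\subset\Omega_n$ and $\delta>0$, let $$\gamma(\mathcal{A},\epsilon,\delta)=\mathbf{P}\Bigl\{x\in\Omega_n:\bigl|\mathbf{P}(N_\epsilon(x)\in\mathcal{A}\mid x)-\mathbf{P}(\mathcal{A})\bigr|>\delta\Bigr\},\qquad \phi(\mathcal{A},\epsilon)=\inf\{\delta>0:\gamma(\mathcal{A},\epsilon,\delta)<\delta\}.$$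 A sequence of events $\mathcal{A}_m\subset\Omega_{n_m}$ is asymptotically noise sensitive if $\lim_{m\to\infty}\phi(\mathcal{A}_m,\epsilon)=0$ for every $\epsilon\in(0,1/2)$. *)

theory Defs
  imports "HOL-Probability.Probability"
begin

text \<open>
  The discrete cube over the coordinates \<open>1, \<dots>, n\<close>. The values 0 and 1 are the booleans
  \<open>False\<close> and \<open>True\<close> (so \<open>0 \<le> 1\<close> is the order of \<^typ>\<open>bool\<close>, and
  \<open>1 - x\<^sub>j\<close> is negation). Points are functions that are \<^term>\<open>undefined\<close> off \<open>{1..n}\<close>.
\<close>

definition cube :: "nat \<Rightarrow> (nat \<Rightarrow> bool) set" where
  "cube n = PiE {1..n} (\<lambda>_. UNIV)"

definition unif :: "nat \<Rightarrow> (nat \<Rightarrow> bool) pmf" where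
  "unif n = pmf_of_set (cube n)"

definition monotone_fun :: "nat \<Rightarrow> ((nat \<Rightarrow> bool) \<Rightarrow> real) \<Rightarrow> bool" where
  "monotone_fun n f \<longleftrightarrow>
     (\<forall>x\<in>cube n. \<forall>y\<in>cube n. (\<forall>j\<in>{1..n}. x j \<le> y j) \<longrightarrow> f x \<le> f y)"

definition monotone_event :: "nat \<Rightarrow> (nat \<Rightarrow> bool) set \<Rightarrow> bool" where
  "monotone_event n A \<longleftrightarrow> monotone_fun n (indicator A)"

definition flip :: "nat \<Rightarrow> (nat \<Rightarrow> bool) \<Rightarrow> (nat \<Rightarrow> bool)" where
  "flip j x = x(j := \<not> x j)"

definition influence :: "nat \<Rightarrow> nat \<Rightarrow> ((nat \<Rightarrow> bool) \<Rightarrow> real) \<Rightarrow> real" where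
  "influence n k f = measure_pmf.expectation (unif n) (\<lambda>x. \<bar>f (flip k x) - f x\<bar>)"

definition influence_sq :: "nat \<Rightarrow> ((nat \<Rightarrow> bool) \<Rightarrow> real) \<Rightarrow> real" where
  "influence_sq n f = (\<Sum>k=1..n. (influence n k f)\<^sup>2)"

definition event_influence_sq :: "nat \<Rightarrow> (nat \<Rightarrow> bool) set \<Rightarrow> real" where
  "event_influence_sq n A = influence_sq n (indicator A)"

text \<open>
  Distribution of the noisy point: the Bernoulli variables decide which coordinates are negated,
  and the default value \<^term>\<open>undefined\<close> of the product keeps the result in the cube.
\<close>

definition noise :: "nat \<Rightarrow> real \<Rightarrow> (nat \<Rightarrow> bool) \<Rightarrow> (nat \<Rightarrow> bool) pmf" where
  "noise n \<epsilon> x =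
     Pi_pmf {1..n} undefined
       (\<lambda>j. map_pmf (\<lambda>b. if b then \<not> x j else x j) (bernoulli_pmf \<epsilon>))"

definition sens_prob :: "nat \<Rightarrow> (nat \<Rightarrow> bool) set \<Rightarrow> real \<Rightarrow> real \<Rightarrow> real" where
  "sens_prob n A \<epsilon> \<delta> =
     measure_pmf.prob (unif n)
       {x \<in> cube n. \<bar>measure_pmf.prob (noise n \<epsilon> x) A - measure_pmf.prob (unif n) A\<bar> > \<delta>}"

definition sens_gauge :: "nat \<Rightarrow> (nat \<Rightarrow> bool) set \<Rightarrow> real \<Rightarrow> real" where
  "sens_gauge n A \<epsilon> = Inf {\<delta>. \<delta> > 0 \<and> sens_prob n A \<epsilon> \<delta> < \<delta>}"

definition asymp_noise_sensitive ::
    "(nat \<Rightarrow> nat) \<Rightarrow> (nat \<Rightarrow> (nat \<Rightarrow> bool) set) \<Rightarrow> bool" where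
  "asymp_noise_sensitive n A \<longleftrightarrow>
     (\<forall>\<epsilon>. 0 < \<epsilon> \<and> \<epsilon> < 1/2 \<longrightarrow> (\<lambda>m. sens_gauge (n m) (A m) \<epsilon>) \<longlonglongrightarrow> 0)"

lemma finite_cube: "finite (cube n)"
  by (simp add: cube_def finite_PiE)

lemma cube_nonempty: "cube n \<noteq> {}"
  by (simp add: cube_def PiE_eq_empty_iff)

lemma flip_in_cube: "x \<in> cube n \<Longrightarrow> k \<in> {1..n} \<Longrightarrow> flip k x \<in> cube n"
  by (auto simp: cube_def flip_def PiE_iff extensional_def)

lemma set_noise: "set_pmf (noise n \<epsilon> x) \<subseteq> cube n"
  using set_Pi_pmf_subset[of "{1..n}"] by (simp add: noise_def cube_def PiE_def extensional_def)

end

theory Submission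
  imports Defs
begin

text \<open>
  The Fourier coefficients of a monotone event on single coordinates are half its influences, and
  the noise operator multiplies them by \<open>1 - 2\<epsilon>\<close>. By Bessel's inequality the
  variance of \<open>x \<mapsto> P(N\<^sub>\<epsilon>(x) \<in> A | x)\<close> is then at least
  \<open>((1 - 2\<epsilon>) / 2)\<^sup>2\<close> times the sum of the squared influences. On the other
  hand this variance is at most \<open>\<delta>\<^sup>2 + \<gamma>(A, \<epsilon>, \<delta>)\<close>, so
  the gauge cannot be small.
\<close>

section \<open>Degree-one Fourier analysis on the cube\<close>

text \<open>The Walsh character of one coordinate, with its sign chosen to be increasing, so that
  monotone functions have nonnegative coefficients.\<close>

definition coord_sign :: "nat \<Rightarrow> (nat \<Rightarrow> bool) \<Rightarrow> real" where
  "coord_sign k x = (if x k then 1 else -1)"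

lemma coord_sign_flip_same: "coord_sign k (flip k x) = - coord_sign k x"
  by (simp add: coord_sign_def flip_def)

lemma coord_sign_flip_other: "k \<noteq> l \<Longrightarrow> coord_sign l (flip k x) = coord_sign l x"
  by (simp add: coord_sign_def flip_def)

lemma card_cube_pos: "card (cube n) > 0"
  by (simp add: card_gt_0_iff finite_cube cube_nonempty)

lemma expectation_unif:
  fixes f :: "(nat \<Rightarrow> bool) \<Rightarrow> real"
  shows "measure_pmf.expectation (unif n) f = (\<Sum>x\<in>cube n. f x) / card (cube n)"
  by (simp add: unif_def integral_pmf_of_set finite_cube cube_nonempty)

lemma prob_unif:
  "measure_pmf.prob (unif n) B = (\<Sum>x\<in>cube n. indicator B x) / card (cube n)"
proof -
  have "measure_pmf.prob (unif n) B = measure_pmf.expectation (unif n) (indicator B)"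
    by simp
  then show ?thesis
    by (simp only: expectation_unif)
qed

text \<open>Flipping a coordinate is an involution of the cube. Every cancellation below comes from
  this substitution.\<close>

lemma sum_cube_flip:
  fixes f :: "(nat \<Rightarrow> bool) \<Rightarrow> real"
  assumes "k \<in> {1..n}"
  shows "(\<Sum>x\<in>cube n. f (flip k x)) = (\<Sum>x\<in>cube n. f x)"
  by (rule sum.reindex_bij_witness[of _ "flip k" "flip k"])
    (use assms flip_in_cube in \<open>auto simp: flip_def\<close>)

lemma sum_coord_sign:
  assumes "k \<in> {1..n}"
  shows "(\<Sum>x\<in>cube n. coord_sign k x) = 0"
  using sum_cube_flip[OF assms, of "coord_sign k"]
  by (simp add: coord_sign_flip_same sum_negf)

text \<open>Off the diagonal, \<open>flip k\<close> negates exactly one factor, so the sum equals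
  its own negative.\<close>

lemma sum_coord_sign_mult:
  assumes "k \<in> {1..n}"
  shows "(\<Sum>x\<in>cube n. coord_sign k x * coord_sign l x) = (if k = l then card (cube n) else 0)"
proof (cases "k = l")
  case True
  then have "coord_sign k x * coord_sign l x = 1" for x
    by (simp add: coord_sign_def)
  with True show ?thesis
    by simp
next
  case False
  then show ?thesis
    using sum_cube_flip[OF assms, of "\<lambda>x. coord_sign k x * coord_sign l x"]
    by (simp add: coord_sign_flip_same coord_sign_flip_other sum_negf)
qed

text \<open>The only use of monotonicity: it fixes the sign of the increment of \<open>f\<close>
  along each edge in direction \<open>k\<close>, so the absolute value becomes a signed sum over the
  two endpoints. Both endpoints contribute equally after summation, whence the factor 2.\<close>

lemma sum_coord_sign_monotone:
  assumes "monotone_fun n f" "k \<in> {1..n}"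
  shows "(\<Sum>x\<in>cube n. coord_sign k x * f x) = card (cube n) * influence n k f / 2"
proof -
  have "\<bar>f (flip k x) - f x\<bar> = coord_sign k x * f x + coord_sign k (flip k x) * f (flip k x)"
    if x: "x \<in> cube n" for x
  proof (cases "x k")
    case True
    then have "\<forall>j\<in>{1..n}. flip k x j \<le> x j"
      by (simp add: flip_def)
    then have "f (flip k x) \<le> f x"
      using assms x flip_in_cube[OF x assms(2)] unfolding monotone_fun_def by blast
    then show ?thesis
      using True by (simp add: coord_sign_def flip_def)
  next
    case False
    then have "\<forall>j\<in>{1..n}. x j \<le> flip k x j"
      by (simp add: flip_def)
    then have "f x \<le> f (flip k x)"
      using assms x flip_in_cube[OF x assms(2)] unfolding monotone_fun_def by blast
    then show ?thesis
      using False by (simp add: coord_sign_def flip_def)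
  qed
  then have "(\<Sum>x\<in>cube n. \<bar>f (flip k x) - f x\<bar>) = 2 * (\<Sum>x\<in>cube n. coord_sign k x * f x)"
    using sum_cube_flip[OF assms(2), of "\<lambda>x. coord_sign k x * f x"]
    by (simp add: sum.distrib)
  then show ?thesis
    using card_cube_pos[of n] by (simp add: influence_def expectation_unif)
qed

section \<open>The noise kernel and its action on coordinate signs\<close>

text \<open>The transition probability depends only on the set of coordinates where the two points
  differ. This symmetry makes the noise operator self-adjoint.\<close>

lemma pmf_noise_commute:
  assumes "0 \<le> \<epsilon>" "\<epsilon> \<le> 1" "x \<in> cube n" "y \<in> cube n"
  shows "pmf (noise n \<epsilon> x) y = pmf (noise n \<epsilon> y) x"
proof -
  have coord: "pmf (map_pmf (\<lambda>b. if b then \<not> u else u) (bernoulli_pmf \<epsilon>)) v =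
      (if u = v then 1 - \<epsilon> else \<epsilon>)" for u v
  proof -
    \<comment> \<open>The value \<open>v\<close> has exactly one preimage under this injective map,
      namely \<open>u \<noteq> v\<close>.\<close>
    have "pmf (map_pmf (\<lambda>b. if b then \<not> u else u) (bernoulli_pmf \<epsilon>))
        ((\<lambda>b. if b then \<not> u else u) (u \<noteq> v)) = pmf (bernoulli_pmf \<epsilon>) (u \<noteq> v)"
      by (rule pmf_map_inj') (auto simp: inj_def split: if_splits)
    moreover have "(if u \<noteq> v then \<not> u else u) = v"
      by auto
    ultimately show ?thesis
      using assms(1,2) by (simp split: if_splits)
  qed
  \<comment> \<open>Membership of \<open>v\<close> in the cube gives it the default value
    \<open>undefined\<close> off \<open>{1..n}\<close>; otherwise its mass could vanish.\<close>
  have "pmf (noise n \<epsilon> u) v = (\<Prod>j\<in>{1..n}. if u j = v j then 1 - \<epsilon> else \<epsilon>)"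
    if "v \<in> cube n" for u v
    unfolding noise_def using that
    by (subst pmf_Pi') (auto simp: coord cube_def PiE_iff extensional_def)
  then show ?thesis
    using assms(3,4) by (auto intro!: prod.cong)
qed

text \<open>Only the marginal at \<open>k\<close> matters: the sign is kept with probability
  \<open>1 - \<epsilon>\<close> and reversed with probability \<open>\<epsilon>\<close>.\<close>

lemma expectation_noise_coord_sign:
  assumes "0 \<le> \<epsilon>" "\<epsilon> \<le> 1" "k \<in> {1..n}"
  shows "measure_pmf.expectation (noise n \<epsilon> y) (coord_sign k) = (1 - 2 * \<epsilon>) * coord_sign k y"
proof -
  have "measure_pmf.expectation (noise n \<epsilon> y) (coord_sign k) =
      measure_pmf.expectation (map_pmf (\<lambda>x. x k) (noise n \<epsilon> y)) (\<lambda>b. if b then 1 else -1)"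
    by (simp add: coord_sign_def[abs_def])
  also have "map_pmf (\<lambda>x. x k) (noise n \<epsilon> y) =
      map_pmf (\<lambda>b. if b then \<not> y k else y k) (bernoulli_pmf \<epsilon>)"
    using assms(3) unfolding noise_def by (subst Pi_pmf_component) auto
  finally show ?thesis
    using assms(1,2) by (cases "y k") (simp_all add: coord_sign_def[of k y])
qed

text \<open>By self-adjointness the noise moves from the event to the sign, which is an
  eigenfunction.\<close>

lemma sum_coord_sign_noise:
  assumes "0 \<le> \<epsilon>" "\<epsilon> \<le> 1" "k \<in> {1..n}" "A \<subseteq> cube n"
  shows "(\<Sum>x\<in>cube n. coord_sign k x * measure_pmf.prob (noise n \<epsilon> x) A) =
    (1 - 2 * \<epsilon>) * (\<Sum>x\<in>cube n. coord_sign k x * indicator A x)"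
proof -
  have "(\<Sum>x\<in>cube n. coord_sign k x * measure_pmf.prob (noise n \<epsilon> x) A) =
      (\<Sum>x\<in>cube n. \<Sum>y\<in>A. coord_sign k x * pmf (noise n \<epsilon> x) y)"
    using finite_subset[OF assms(4) finite_cube]
    by (simp add: measure_measure_pmf_finite sum_distrib_left)
  also have "\<dots> = (\<Sum>y\<in>A. \<Sum>x\<in>cube n. coord_sign k x * pmf (noise n \<epsilon> y) x)"
    by (subst sum.swap, intro sum.cong refl arg_cong2[where f = "(*)"] pmf_noise_commute)
      (use assms in auto)
  also have "\<dots> = (\<Sum>y\<in>A. measure_pmf.expectation (noise n \<epsilon> y) (coord_sign k))"
    by (intro sum.cong refl integral_measure_pmf_real[symmetric] finite_cube)
      (use set_noise in auto)
  also have "\<dots> = (1 - 2 * \<epsilon>) * (\<Sum>y\<in>A. coord_sign k y)"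
    by (simp only: expectation_noise_coord_sign[OF assms(1-3)] sum_distrib_left)
  also have "(\<Sum>y\<in>A. coord_sign k y) = (\<Sum>x\<in>cube n. coord_sign k x * indicator A x)"
    using assms(4) by (intro sum.mono_neutral_cong_left finite_cube) auto
  finally show ?thesis .
qed

section \<open>Two-sided estimate of the variance of the noisy probability\<close>

lemma influence_sq_le_noise_variance:
  assumes "0 \<le> \<epsilon>" "\<epsilon> \<le> 1" "A \<subseteq> cube n" "monotone_event n A"
  shows "((1 - 2 * \<epsilon>) / 2)\<^sup>2 * event_influence_sq n A \<le> measure_pmf.expectation (unif n)
    (\<lambda>x. (measure_pmf.prob (noise n \<epsilon> x) A - measure_pmf.prob (unif n) A)\<^sup>2)"
proof -
  define g where
    "g x = measure_pmf.prob (noise n \<epsilon> x) A - measure_pmf.prob (unif n) A" for x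
  define I where "I k = influence n k (indicator A)" for k
  \<comment> \<open>With \<open>t\<close> as below, \<open>t * h x\<close> is the orthogonal
    projection of \<open>g\<close> onto the span of the coordinate signs; Bessel's inequality
    follows by expanding the squared distance from \<open>g\<close> to it.\<close>
  define h where "h x = (\<Sum>k=1..n. I k * coord_sign k x)" for x
  define t where "t = (1 - 2 * \<epsilon>) / 2"
  define N where "N = real (card (cube n))"
  define W where "W = event_influence_sq n A"
  have W: "W = (\<Sum>k=1..n. (I k)\<^sup>2)"
    by (simp add: W_def event_influence_sq_def influence_sq_def I_def)
  have coeff: "(\<Sum>x\<in>cube n. coord_sign k x * g x) = t * N * I k" if k: "k \<in> {1..n}" for k
  proof -
    \<comment> \<open>Centering leaves the coefficient unchanged, because the signs have mean
      zero.\<close>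
    have "(\<Sum>x\<in>cube n. coord_sign k x * g x) =
        (\<Sum>x\<in>cube n. coord_sign k x * measure_pmf.prob (noise n \<epsilon> x) A)
        - (\<Sum>x\<in>cube n. coord_sign k x) * measure_pmf.prob (unif n) A"
      by (simp add: g_def right_diff_distrib sum_subtractf sum_distrib_right)
    also have "\<dots> = (1 - 2 * \<epsilon>) * (N * I k / 2)"
      unfolding sum_coord_sign[OF k] sum_coord_sign_noise[OF assms(1,2) k assms(3)]
        sum_coord_sign_monotone[OF assms(4)[unfolded monotone_event_def] k] I_def N_def
      by simp
    finally show ?thesis
      by (simp add: t_def)
  qed
  have hg: "(\<Sum>x\<in>cube n. h x * g x) = t * N * W"
  proof -
    have "(\<Sum>x\<in>cube n. h x * g x) = (\<Sum>k=1..n. I k * (\<Sum>x\<in>cube n. coord_sign k x * g x))"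
      unfolding h_def sum_distrib_right sum_distrib_left
      by (subst sum.swap) (simp add: mult.assoc)
    also have "\<dots> = (\<Sum>k=1..n. t * N * (I k)\<^sup>2)"
      by (intro sum.cong refl) (simp add: coeff power2_eq_square)
    finally show ?thesis
      by (simp add: W sum_distrib_left)
  qed
  have hh: "(\<Sum>x\<in>cube n. h x * h x) = N * W"
  proof -
    have "(\<Sum>x\<in>cube n. h x * h x) =
        (\<Sum>k=1..n. I k * (\<Sum>x\<in>cube n. coord_sign k x * h x))"
      by (subst (1) h_def, unfold sum_distrib_right sum_distrib_left,
          subst sum.swap) (simp add: mult.assoc)
    also have "\<dots> = (\<Sum>k=1..n. N * (I k)\<^sup>2)"
    proof (intro sum.cong refl)
      fix k assume k: "k \<in> {1..n}"
      have "(\<Sum>x\<in>cube n. coord_sign k x * h x) =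
          (\<Sum>l=1..n. I l * (\<Sum>x\<in>cube n. coord_sign k x * coord_sign l x))"
        unfolding h_def sum_distrib_left by (subst sum.swap) (simp add: mult_ac)
      also have "\<dots> = (\<Sum>l=1..n. if k = l then I l * N else 0)"
        using k by (intro sum.cong refl) (simp add: sum_coord_sign_mult N_def)
      also have "\<dots> = I k * N"
        using k by simp
      finally show "I k * (\<Sum>x\<in>cube n. coord_sign k x * h x) = N * (I k)\<^sup>2"
        by (simp add: power2_eq_square)
    qed
    finally show ?thesis
      by (simp add: W sum_distrib_left)
  qed
  have expand: "(g x - t * h x)\<^sup>2 = (g x)\<^sup>2 - 2 * t * (h x * g x) + t\<^sup>2 * (h x * h x)" for x
    by (simp add: power2_eq_square algebra_simps)
  have "0 \<le> (\<Sum>x\<in>cube n. (g x - t * h x)\<^sup>2)"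
    by (simp add: sum_nonneg)
  also have "\<dots> = (\<Sum>x\<in>cube n. (g x)\<^sup>2) - 2 * t * (\<Sum>x\<in>cube n. h x * g x)
      + t\<^sup>2 * (\<Sum>x\<in>cube n. h x * h x)"
    by (simp add: expand sum.distrib sum_subtractf sum_distrib_left)
  \<comment> \<open>The cross term contributes \<open>-2 * t\<^sup>2 * W * N\<close> and the last
    term gives half of it back.\<close>
  also have "\<dots> = (\<Sum>x\<in>cube n. (g x)\<^sup>2) - t\<^sup>2 * W * N"
    by (simp add: hg hh power2_eq_square)
  finally have "t\<^sup>2 * W * N \<le> (\<Sum>x\<in>cube n. (g x)\<^sup>2)"
    by simp
  moreover have "N > 0"
    by (simp add: N_def card_cube_pos)
  ultimately show ?thesis
    by (simp add: expectation_unif pos_le_divide_eq flip: g_def t_def N_def W_def)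
qed

text \<open>Split the cube at the exceptional set: outside it the deviation is at most
  \<open>\<delta>\<close>, and on it at most 1, as a difference of two probabilities.\<close>

lemma noise_variance_le:
  assumes "\<delta> > 0"
  shows "measure_pmf.expectation (unif n)
      (\<lambda>x. (measure_pmf.prob (noise n \<epsilon> x) A - measure_pmf.prob (unif n) A)\<^sup>2)
    \<le> \<delta>\<^sup>2 + sens_prob n A \<epsilon> \<delta>"
proof -
  define g where
    "g x = measure_pmf.prob (noise n \<epsilon> x) A - measure_pmf.prob (unif n) A" for x
  define B where "B = {x \<in> cube n. \<bar>g x\<bar> > \<delta>}"
  have "(g x)\<^sup>2 \<le> \<delta>\<^sup>2 + indicator B x" if "x \<in> cube n" for x
  proof (cases "x \<in> B")
    case True
    have "\<bar>g x\<bar> \<le> 1"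
      unfolding g_def using measure_pmf.prob_le_1[of "noise n \<epsilon> x" A]
        measure_pmf.prob_le_1[of "unif n" A] measure_nonneg[of "noise n \<epsilon> x" A]
        measure_nonneg[of "unif n" A] by linarith
    then have "(g x)\<^sup>2 \<le> 1"
      by (simp add: abs_square_le_1)
    with True show ?thesis
      by (simp add: add_increasing)
  next
    case False
    then have "\<bar>g x\<bar> \<le> \<delta>"
      using that by (simp add: B_def)
    then show ?thesis
      using False assms by (simp add: abs_le_square_iff[symmetric])
  qed
  then have "(\<Sum>x\<in>cube n. (g x)\<^sup>2) \<le> card (cube n) * \<delta>\<^sup>2 + (\<Sum>x\<in>cube n. indicator B x)"
    using sum_mono[of "cube n" "\<lambda>x. (g x)\<^sup>2" "\<lambda>x. \<delta>\<^sup>2 + indicator B x"]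
    by (simp add: sum.distrib)
  then have "(\<Sum>x\<in>cube n. (g x)\<^sup>2) / card (cube n)
      \<le> \<delta>\<^sup>2 + (\<Sum>x\<in>cube n. indicator B x) / card (cube n)"
    using card_cube_pos[of n] by (simp add: field_simps)
  then show ?thesis
    unfolding sens_prob_def g_def[symmetric] B_def[symmetric] expectation_unif
      prob_unif[of n B] .
qed

text \<open>Every admissible \<open>\<delta>\<close> bounds the variance by
  \<open>\<delta>\<^sup>2 + \<delta>\<close>, which is at most \<open>2 * \<delta>\<close> when
  \<open>\<delta> \<le> 1\<close>; larger values are covered by the \<open>min 1\<close>. The bound
  is uniform in \<open>n\<close> and \<open>A\<close>.\<close>

lemma sens_gauge_ge:
  assumes "0 \<le> \<epsilon>" "\<epsilon> \<le> 1" "A \<subseteq> cube n" "monotone_event n A"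
    and "c \<le> event_influence_sq n A"
  shows "min 1 (((1 - 2 * \<epsilon>) / 2)\<^sup>2 * c / 2) \<le> sens_gauge n A \<epsilon>"
  unfolding sens_gauge_def
proof (rule cInf_greatest)
  \<comment> \<open>The infimum must range over a nonempty set; any value above 1 is admissible,
    here 2.\<close>
  have "sens_prob n A \<epsilon> 2 \<le> 1"
    unfolding sens_prob_def by (rule measure_pmf.prob_le_1)
  then have "(2::real) \<in> {\<delta>. \<delta> > 0 \<and> sens_prob n A \<epsilon> \<delta> < \<delta>}"
    by simp
  then show "{\<delta>. \<delta> > 0 \<and> sens_prob n A \<epsilon> \<delta> < \<delta>} \<noteq> {}"
    by blast
next
  fix \<delta> assume "\<delta> \<in> {\<delta>. \<delta> > 0 \<and> sens_prob n A \<epsilon> \<delta> < \<delta>}"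
  then have \<delta>: "\<delta> > 0" "sens_prob n A \<epsilon> \<delta> < \<delta>"
    by auto
  have "((1 - 2 * \<epsilon>) / 2)\<^sup>2 * c \<le> ((1 - 2 * \<epsilon>) / 2)\<^sup>2 * event_influence_sq n A"
    by (intro mult_left_mono assms) simp
  also note influence_sq_le_noise_variance[OF assms(1-4)]
  also note noise_variance_le[OF \<delta>(1)]
  finally have le: "((1 - 2 * \<epsilon>) / 2)\<^sup>2 * c \<le> \<delta>\<^sup>2 + \<delta>"
    using \<delta>(2) by linarith
  show "min 1 (((1 - 2 * \<epsilon>) / 2)\<^sup>2 * c / 2) \<le> \<delta>"
  proof (cases "\<delta> \<le> 1")
    case True
    then have "\<delta>\<^sup>2 \<le> \<delta>"
      using \<delta>(1) by (simp add: power2_eq_square mult_left_le)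
    then show ?thesis
      using le by linarith
  qed linarith
qed

theorem theorem1p4:
  fixes n :: "nat \<Rightarrow> nat" and A :: "nat \<Rightarrow> (nat \<Rightarrow> bool) set"
  assumes "\<And>m. m \<ge> 1 \<Longrightarrow> A m \<subseteq> cube (n m)"
    and "\<And>m. m \<ge> 1 \<Longrightarrow> monotone_event (n m) (A m)"
    and "(INF m\<in>{1..}. event_influence_sq (n m) (A m)) > 0"
  shows "\<not> asymp_noise_sensitive n A"
proof
  assume "asymp_noise_sensitive n A"
  \<comment> \<open>Any fixed noise level in \<open>(0, 1/2)\<close> would serve, since
    \<open>1 - 2 * \<epsilon>\<close> is then nonzero.\<close>
  then have lim: "(\<lambda>m. sens_gauge (n m) (A m) (1/4)) \<longlonglongrightarrow> 0"
    by (simp add: asymp_noise_sensitive_def)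
  define c where "c = (INF m\<in>{1..}. event_influence_sq (n m) (A m))"
  define b where "b = min 1 (((1 - 2 * (1/4)) / 2)\<^sup>2 * c / 2)"
  \<comment> \<open>A real infimum is a lower bound only for a set bounded below; here 0 is a
    bound.\<close>
  have "bdd_below ((\<lambda>m. event_influence_sq (n m) (A m)) ` {1..})"
    by (intro bdd_belowI[of _ 0])
      (auto simp: event_influence_sq_def influence_sq_def intro!: sum_nonneg)
  then have "c \<le> event_influence_sq (n m) (A m)" if "m \<ge> 1" for m
    unfolding c_def using that by (intro cINF_lower) auto
  then have "b \<le> sens_gauge (n m) (A m) (1/4)" if "m \<ge> 1" for m
    unfolding b_def using that assms(1,2) by (intro sens_gauge_ge) auto
  \<comment> \<open>The bound holds from \<open>m = 1\<close> on, which suffices for the limit;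
    nothing is assumed about \<open>A 0\<close>.\<close>
  then have "b \<le> 0"
    by (intro LIMSEQ_le_const[OF lim]) auto
  moreover have "b > 0"
    using assms(3) by (simp add: b_def c_def)
  ultimately show False
    by simp
qed

end
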